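(* Let $\mathbf{X}=(\mathbf{X}_n)_{n\in\mathbb{N}}$ be the iterate process generated by the recursive adaptive stochastic Frank–Wolfe algorithm (defined in the context) with starting random variable $\mathbf{X}_0$, domain approximation process $\mathbf{D}$ and objective approximation process $\mathbf{F}$. Let $\beta_1,\beta_2,\varepsilon\in[0,1]$ and $\eta_1,\eta_2\ge 0$ be such that (i) $\mathbb{P}\big[\limsup_{n\to\infty} d_H(\mathbf{D}_n,D)\le\eta_1\big]\ge 1-\beta_1$; (ii) $E\in\mathscr{D}$ satisfies $D\subseteq E\subseteq\operatorname{dom}(f)$ and $\mathbb{P}\big[\bigcup_{n\in\mathbb{N}}\mathbf{D}_n\subseteq E\big]\ge 1-\varepsilon$; (iii) $\mathbb{P}\big[\limsup_{n\to\infty}\lVert \mathbf{F}_n-f\rVert_\infty\le\eta_2\big]\ge 1-\beta_2$. Let $\Delta=\operatorname{diam}(E)$ and $L=\max\{\lVert\nabla f(x)\rVert: x\in E\}$. Then $$\mathbb{P}\Big[-\eta_1L\le\liminf_{n\to\infty} f(\mathbf{X}_n)-P^\star\le\limsup_{n\to\infty} f(\mathbf{X}_n)-P^\star\le\eta_1L+2\eta_2\Delta\Big]\ge 1-(\beta_1+\beta_2+\varepsilon).$$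
   Context: $\mathbb{N}=\{1,2,\dots\}$, $\mathbb{N}_0=\mathbb{N}\cup\{0\}$. $H$ is a finite-dimensional real Hilbert space with inner product $\langle\cdot\mid\cdot\rangle$ and induced norm $\lVert\cdot\rVert$. $f:\operatorname{dom}(f)\to\mathbb{R}$ is convex and continuously differentiable, with $\operatorname{dom}(f)\subseteq H$ closed; $D\subseteq\operatorname{dom}(f)$ is nonempty, compact and convex; $P^\star=\min_{x\in D}f(x)$. $(\Omega,\Sigma,\mathbb{P})$ is a complete probability space. $\mathscr{D}$ is the set of nonempty compact convex subsets of $H$ with the Hausdorff metric $d_H(X,Y)=\max\{\sup_{x\in X}\inf_{y\in Y}\lVert x-y\rVert,\ \sup_{y\in Y}\inf_{x\in X}\lVert x-y\rVert\}$ and its Borel $\sigma$-algebra. A domain approximation process is a stochastic process $\mathbf{D}:\mathbb{N}\times\Omega\to\mathscr{D}$, i.e. each $\mathbf{D}_n:\Omega\to\mathscr{D}$ is measurable. Given $E\in\mathscr{D}$ with $D\subseteq E\subseteq\operatorname{dom}(f)$ (the uniform extension domain), $\mathscr{F}=\{g\in C^1(E,\mathbb{R}): g\text{ convex}\}$ carries the norm $\lVert g\rVert_\infty=\sup_{x\in E}|g(x)|+\sup_{x\in E}\lVert\nabla g(x)\rVert$ (also used for differences of elements of $\mathscr{F}$, with $f$ restricted to $E$) and the corresponding Borel $\sigma$-algebra. An objective approximation process is a stochastic process $\mathbf{F}:\mathbb{N}\times\Omega\to\mathscr{F}$, i.e. each $\mathbf{F}_n:\Omega\to\mathscr{F}$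 is measurable. Algorithm: $\mathbf{X}_0:\Omega\to H$ is measurable with $\mathbf{X}_0\in E$ almost surely. Put $N=\{\bigcup_{n\in\mathbb{N}}\mathbf{D}_n\subseteq E\}\cap\{\mathbf{X}_0\in E\}\in\Sigma$ and $\lambda_n=2/(n+2)$. For $n\in\mathbb{N}_0$, $\mathbf{S}_{n+1}:\Omega\to H$ is a measurable selection with $$\mathbf{S}_{n+1}(\omega)\in\operatorname{arg\,min}\{\mathbf{1}_N(\omega)\langle s\mid\nabla\mathbf{F}_{n+1}(\omega)(\mathbf{X}_n(\omega))\rangle: s\in\mathbf{D}_{n+1}(\omega)\}\quad\text{for all }\omega\in\Omega$$ (the objective is read as $0$ for $\omega\notin N$), and $\mathbf{X}_{n+1}=\mathbf{X}_n+\lambda_n(\mathbf{S}_{n+1}-\mathbf{X}_n)$. On $N$ all $\mathbf{X}_n$ lie in $E$. *)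

theory Defs
  imports "HOL-Probability.Probability"
begin

definition convex_bodies :: "'a::euclidean_space set set" where
  "convex_bodies = {K. K \<noteq> {} \<and> compact K \<and> convex K}"

definition hausdorff_dist :: "'a::euclidean_space set \<Rightarrow> 'a set \<Rightarrow> real" where
  "hausdorff_dist X Y = max (SUP x\<in>X. infdist x Y) (SUP y\<in>Y. infdist y X)"

text \<open>
  The Borel \<open>\<sigma>\<close>-algebra of the metric space \<open>(A, d)\<close>. The locale \<open>Metric_space\<close> is not used, since it
  wants nonnegativity and symmetry of \<open>d\<close> outside the carrier as well, where the suprema
  below are unspecified.
\<close>

definition metric_borel :: "'b set \<Rightarrow> ('b \<Rightarrow> 'b \<Rightarrow> real) \<Rightarrow> 'b measure" where
  "metric_borel A d =
     sigma A {U. U \<subseteq> A \<and> (\<forall>x\<in>U. \<exists>r>0. \<forall>y\<in>A. d x y < r \<longrightarrow> y \<in> U)}"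

text \<open>
  Gradient of a function on a convex set \<open>S\<close>, which may have boundary points or empty interior: the
  vector representing the derivative within \<open>S\<close> that is tangential to \<open>S\<close>, i.e. lies in the
  linear space parallel to the affine hull of \<open>S\<close>. Without the tangentiality condition it would not
  be unique for lower-dimensional \<open>S\<close>; in the interior of \<open>S\<close> it is the usual gradient
  (\<open>gradient_on_interior\<close> below).
\<close>

definition is_gradient_on :: "'a::euclidean_space set \<Rightarrow> ('a \<Rightarrow> real) \<Rightarrow> 'a \<Rightarrow> 'a \<Rightarrow> bool" where
  "is_gradient_on S g x v \<longleftrightarrow>
     v \<in> span {y - z |y z. y \<in> S \<and> z \<in> S} \<and> (g has_derivative (\<lambda>h. v \<bullet> h)) (at x within S)"

definition gradient_on :: "'a::euclidean_space set \<Rightarrow> ('a \<Rightarrow> real) \<Rightarrow> 'a \<Rightarrow> 'a" where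
  "gradient_on S g x = (THE v. is_gradient_on S g x v)"

definition C1_on :: "'a::euclidean_space set \<Rightarrow> ('a \<Rightarrow> real) \<Rightarrow> bool" where
  "C1_on S g \<longleftrightarrow> g differentiable_on S \<and> continuous_on S (gradient_on S g)"

text \<open>Functions on \<open>E\<close> are represented by their extensions that are \<open>undefined\<close> outside \<open>E\<close>.\<close>

definition convex_C1 :: "'a::euclidean_space set \<Rightarrow> ('a \<Rightarrow> real) set" where
  "convex_C1 E = {g \<in> extensional E. C1_on E g \<and> convex_on E g}"

definition C1_norm :: "'a::euclidean_space set \<Rightarrow> ('a \<Rightarrow> real) \<Rightarrow> real" where
  "C1_norm E g = (SUP x\<in>E. \<bar>g x\<bar>) + (SUP x\<in>E. norm (gradient_on E g x))"

definition C1_dist :: "'a::euclidean_space set \<Rightarrow> ('a \<Rightarrow> real) \<Rightarrow> ('a \<Rightarrow> real) \<Rightarrow> real" where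
  "C1_dist E g h = C1_norm E (\<lambda>x. g x - h x)"

definition domain_approximation_process ::
    "'w measure \<Rightarrow> (nat \<Rightarrow> 'w \<Rightarrow> 'a::euclidean_space set) \<Rightarrow> bool" where
  "domain_approximation_process M Dn \<longleftrightarrow>
     (\<forall>n\<ge>1. Dn n \<in> M \<rightarrow>\<^sub>M metric_borel convex_bodies hausdorff_dist)"

definition objective_approximation_process ::
    "'w measure \<Rightarrow> 'a::euclidean_space set \<Rightarrow> (nat \<Rightarrow> 'w \<Rightarrow> 'a \<Rightarrow> real) \<Rightarrow> bool" where
  "objective_approximation_process M E Fn \<longleftrightarrow>
     (\<forall>n\<ge>1. Fn n \<in> M \<rightarrow>\<^sub>M metric_borel (convex_C1 E) (C1_dist E))"

definition feasible_event ::
    "'w measure \<Rightarrow> 'a set \<Rightarrow> (nat \<Rightarrow> 'w \<Rightarrow> 'a set) \<Rightarrow> ('w \<Rightarrow> 'a) \<Rightarrow> 'w set" where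
  "feasible_event M E Dn X0 = {\<omega> \<in> space M. (\<Union>n\<in>{1..}. Dn n \<omega>) \<subseteq> E \<and> X0 \<omega> \<in> E}"

text \<open>
  \<open>X\<close> (started at \<open>X 0\<close>) and \<open>S\<close> (with \<open>S 0\<close> irrelevant) are the iterates and the selected minimizers
  of a run of the adaptive stochastic Frank--Wolfe algorithm.
\<close>

definition frank_wolfe_process ::
    "'w measure \<Rightarrow> 'a::euclidean_space set \<Rightarrow> (nat \<Rightarrow> 'w \<Rightarrow> 'a set) \<Rightarrow> (nat \<Rightarrow> 'w \<Rightarrow> 'a \<Rightarrow> real) \<Rightarrow>
     (nat \<Rightarrow> 'w \<Rightarrow> 'a) \<Rightarrow> (nat \<Rightarrow> 'w \<Rightarrow> 'a) \<Rightarrow> bool" where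
  "frank_wolfe_process M E Dn Fn S X \<longleftrightarrow>
     X 0 \<in> borel_measurable M \<and> (AE \<omega> in M. X 0 \<omega> \<in> E) \<and>
     (\<forall>n. S (Suc n) \<in> borel_measurable M) \<and>
     (\<forall>n. \<forall>\<omega>\<in>space M.
        is_arg_min
          (\<lambda>s. indicat_real (feasible_event M E Dn (X 0)) \<omega> *
               (s \<bullet> gradient_on E (Fn (Suc n) \<omega>) (X n \<omega>)))
          (\<lambda>s. s \<in> Dn (Suc n) \<omega>) (S (Suc n) \<omega>)) \<and>
     (\<forall>n. \<forall>\<omega>\<in>space M.
        X (Suc n) \<omega> = X n \<omega> + (2 / (real n + 2)) *\<^sub>R (S (Suc n) \<omega> - X n \<omega>))"

lemma is_gradient_on_unique:
  assumes S: "convex S" "x \<in> S" and v: "is_gradient_on S g x v" and w: "is_gradient_on S g x w"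
  shows "v = w"
proof -
  define d where "d = v - w"
  have der: "((\<lambda>_. 0) has_derivative (\<lambda>h. d \<bullet> h)) (at x within S)"
    using has_derivative_diff[of g _ _ g] v w
    by (fastforce simp: is_gradient_on_def d_def inner_diff_left)
  have tang: "d \<bullet> (y - x) = 0" if y: "y \<in> S" for y
  proof -
    define c where "c = (\<lambda>t::real. x + t *\<^sub>R (y - x))"
    have cS: "c ` {0..1} \<subseteq> S"
      using convexD_alt[OF S(1) S(2) y] by (auto simp: c_def algebra_simps)
    have "(c has_derivative (\<lambda>t. t *\<^sub>R (y - x))) (at 0 within {0..1})"
      unfolding c_def by (auto intro!: derivative_eq_intros)
    moreover have "((\<lambda>_. 0) has_derivative (\<lambda>h. d \<bullet> h)) (at (c 0) within c ` {0..1})"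
      using has_derivative_subset[OF der cS] by (simp add: c_def)
    ultimately have "((\<lambda>_. 0) has_derivative (\<lambda>t. d \<bullet> (t *\<^sub>R (y - x)))) (at 0 within {0..1::real})"
      using has_derivative_in_compose[of c _ 0 "{0..1}" "\<lambda>_. 0::real" "\<lambda>h. d \<bullet> h"] by (simp only:)
    then have "((\<lambda>_. 0) has_vector_derivative d \<bullet> (y - x)) (at 0 within {0..1::real})"
      by (simp add: has_vector_derivative_def)
    moreover have "((\<lambda>_. 0) has_vector_derivative (0::real)) (at 0 within {0..1::real})"
      by (auto intro: derivative_eq_intros)
    ultimately show ?thesis
      using vector_derivative_unique_within_closed_interval[of 0 1 0 "\<lambda>_. 0::real"] by auto
  qed
  have "orthogonal d u" if "u \<in> span {y - z |y z. y \<in> S \<and> z \<in> S}" for u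
    using that
  proof (rule orthogonal_to_span)
    fix u assume "u \<in> {y - z |y z. y \<in> S \<and> z \<in> S}"
    then obtain y z where "u = (y - x) - (z - x)" "y \<in> S" "z \<in> S"
      by auto
    then show "orthogonal d u"
      using tang by (simp add: orthogonal_def inner_diff_right)
  qed
  moreover have "d \<in> span {y - z |y z. y \<in> S \<and> z \<in> S}"
    using v w by (simp add: d_def is_gradient_on_def span_diff)
  ultimately have "orthogonal d d"
    by blast
  then show ?thesis
    by (simp add: d_def orthogonal_def)
qed

lemma gradient_on_eq:
  "convex S \<Longrightarrow> x \<in> S \<Longrightarrow> is_gradient_on S g x v \<Longrightarrow> gradient_on S g x = v"
  unfolding gradient_on_def using is_gradient_on_unique by blast

lemma is_gradient_on_gradient_on:
  assumes S: "convex S" "x \<in> S" and g: "g differentiable (at x within S)"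
  shows "is_gradient_on S g x (gradient_on S g x)"
proof -
  let ?V = "{y - z |y z. y \<in> S \<and> z \<in> S}"
  obtain g' where g': "(g has_derivative g') (at x within S)"
    using g by (auto simp: differentiable_def)
  interpret bounded_linear g'
    using g' by (rule has_derivative_bounded_linear)
  define a where "a = adjoint g' (1::real)"
  have a: "g' h = a \<bullet> h" for h
    using adjoint_works[OF linear_axioms, of h 1] by (simp add: a_def inner_commute)
  obtain v z where v: "v \<in> span ?V" and z: "\<And>w. w \<in> span ?V \<Longrightarrow> orthogonal z w" and "a = v + z"
    using orthogonal_subspace_decomp_exists by blast
  have eq: "g' (y - x) = v \<bullet> (y - x)" if "y \<in> S" for y
  proof -
    have "y - x \<in> span ?V"
      using that S by (intro span_base) blast
    then show ?thesis
      using z \<open>a = v + z\<close> by (simp add: a inner_add_left orthogonal_def)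
  qed
  have "(g has_derivative (\<lambda>h. v \<bullet> h)) (at x within S)"
    using g' eq S(2) unfolding has_derivative_within_alt by (auto simp: bounded_linear_inner_right)
  with v have "is_gradient_on S g x v"
    by (simp add: is_gradient_on_def)
  then show ?thesis
    using gradient_on_eq[OF S] by metis
qed

lemma gradient_on_interior:
  assumes "convex S" "x \<in> interior S" "GDERIV g x :> v"
  shows "gradient_on S g x = v"
proof (rule gradient_on_eq)
  obtain e where e: "e > 0" "ball x e \<subseteq> S"
    using assms(2) by (auto simp: mem_interior)
  show x: "x \<in> S"
    using assms(2) interior_subset by blast
  have "v \<in> span {y - z |y z. y \<in> S \<and> z \<in> S}"
  proof (cases "v = 0")
    case False
    define u where "u = (e / (2 * norm v)) *\<^sub>R v"
    have "x + u \<in> S"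
      using e False by (auto simp: u_def dist_norm intro!: subsetD[OF e(2)])
    with x have "u \<in> span {y - z |y z. y \<in> S \<and> z \<in> S}"
      by (intro span_base CollectI exI[of _ "x + u"] exI[of _ x]) simp
    then have "(2 * norm v / e) *\<^sub>R u \<in> span {y - z |y z. y \<in> S \<and> z \<in> S}"
      by (rule span_scale)
    then show ?thesis
      using e(1) False by (simp add: u_def)
  qed (simp add: span_zero)
  then show "is_gradient_on S g x v"
    using assms(3) by (auto simp: is_gradient_on_def gderiv_def inner_commute has_derivative_at_withinI)
qed (fact assms(1))

end

theory Submission
  imports Defs "HOL-Real_Asymp.Real_Asymp"
begin

text \<open>
  On the event where all domains stay in \<open>E\<close> and the two error bounds hold, write
  \<open>h\<^sub>n = f (X\<^sub>n) - P\<^sup>\<star>\<close> and \<open>\<lambda>\<^sub>n = 2 / (n + 2)\<close>. Convexity at \<open>X\<^sub>n\<^sub>+\<^sub>1\<close>, uniform continuity of \<open>\<nabla>f\<close> on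
  the compact set \<open>E\<close> and minimality of \<open>S\<^sub>n\<^sub>+\<^sub>1\<close> yield \<open>h\<^sub>n\<^sub>+\<^sub>1 \<le> (1 - \<lambda>\<^sub>n) h\<^sub>n + \<lambda>\<^sub>n c\<^sub>n\<close> with
  \<open>limsup c\<^sub>n \<le> \<eta>\<^sub>1 L + \<eta>\<^sub>2 \<Delta>\<close>, and such a recursion passes the bound on to \<open>limsup h\<^sub>n\<close>. The distance
  of \<open>X\<^sub>n\<close> to the convex set \<open>D\<close> satisfies a recursion of the same kind with limiting bound \<open>\<eta>\<^sub>1\<close>; as \<open>f\<close> is
  \<open>L\<close>-Lipschitz on \<open>E\<close>, this gives the lower bound.
\<close>

section \<open>Limits superior and averaging recursions\<close>

lemma limsup_le_iff_eventually:
  fixes a :: "nat \<Rightarrow> real"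
  shows "limsup (\<lambda>n. ereal (a n)) \<le> ereal C \<longleftrightarrow> (\<forall>e>0. eventually (\<lambda>n. a n \<le> C + e) sequentially)"
proof
  assume *: "limsup (\<lambda>n. ereal (a n)) \<le> ereal C"
  show "\<forall>e>0. eventually (\<lambda>n. a n \<le> C + e) sequentially"
  proof (intro allI impI)
    fix e :: real assume "e > 0"
    then have "ereal C < ereal (C + e)"
      by simp
    then have "eventually (\<lambda>n. ereal (a n) < ereal (C + e)) sequentially"
      using * unfolding Limsup_le_iff by blast
    then show "eventually (\<lambda>n. a n \<le> C + e) sequentially"
      by (auto elim: eventually_mono)
  qed
next
  assume *: "\<forall>e>0. eventually (\<lambda>n. a n \<le> C + e) sequentially"
  show "limsup (\<lambda>n. ereal (a n)) \<le> ereal C"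
  proof (rule ereal_le_epsilon2)
    fix e :: real assume "0 < e"
    then show "limsup (\<lambda>n. ereal (a n)) \<le> ereal C + ereal e"
      using * by (intro Limsup_bounded) simp
  qed
qed

text \<open>
  The hypothesis on \<open>a\<close> says that \<open>n (n + 1) (a\<^sub>n - K)\<close> is nonincreasing as long as \<open>c\<^sub>n \<le> K\<close>.
\<close>

lemma eventually_le_of_averaging:
  fixes a c :: "nat \<Rightarrow> real"
  assumes rec: "\<And>n. a (Suc n) \<le> (1 - 2 / (real n + 2)) * a n + 2 / (real n + 2) * c n"
    and c: "\<And>e. e > 0 \<Longrightarrow> eventually (\<lambda>n. c n \<le> C + e) sequentially"
    and e: "e > 0"
  shows "eventually (\<lambda>n. a n \<le> C + e) sequentially"
proof -
  \<comment> \<open>Half of the slack \<open>e\<close> is spent on \<open>c\<close>; the other half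
    has to absorb the excess of \<open>a n\<close> over \<open>K\<close>.\<close>
  define K where "K = C + e / 2"
  define w where "w n = real n * (real n + 1) * (a n - K)" for n
  obtain N where N: "\<And>n. n \<ge> N \<Longrightarrow> c n \<le> K"
    using c[of "e / 2"] e unfolding K_def eventually_sequentially by auto
  have step: "w (Suc n) \<le> w n" if "n \<ge> N" for n
  proof -
    have avg: "(1 - l) * p + l * q = q + (1 - l) * (p - q)" for l p q :: real
      by (simp add: algebra_simps)
    have "a (Suc n) \<le> (1 - 2 / (real n + 2)) * a n + 2 / (real n + 2) * K"
      using rec[of n] mult_left_mono[OF N[OF that], of "2 / (real n + 2)"] by simp
    also have "\<dots> = K + (1 - 2 / (real n + 2)) * (a n - K)"
      by (rule avg)
    also have "1 - 2 / (real n + 2) = real n / (real n + 2)"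
      by (simp add: field_simps)
    finally have "(real n + 2) * (a (Suc n) - K) \<le> real n * (a n - K)"
      by (simp add: field_simps)
    then have "(real n + 1) * ((real n + 2) * (a (Suc n) - K)) \<le> (real n + 1) * (real n * (a n - K))"
      by (intro mult_left_mono) auto
    then show ?thesis
      by (simp add: w_def algebra_simps)
  qed
  have bound: "w n \<le> w N" if "n \<ge> N" for n
    using that by (induction n rule: dec_induct) (auto intro: order_trans[OF step])
  obtain N' where N': "real N' > 2 * \<bar>w N\<bar> / e"
    using reals_Archimedean2 by blast
  show ?thesis
    unfolding eventually_sequentially
  proof (intro exI allI impI)
    fix n assume n: "max 1 (max N N') \<le> n"
    show "a n \<le> C + e"
    \<comment> \<open>An excess \<open>a n - K\<close> above \<open>e / 2\<close> together with
      \<open>w n \<le> w N\<close> would force \<open>n (n + 1) e\<close> below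
      \<open>2 \<bar>w N\<bar>\<close>, which fails from \<open>N'\<close> on.\<close>
    proof (rule ccontr)
      assume "\<not> a n \<le> C + e"
      then have *: "a n - K > e / 2"
        by (simp add: K_def)
      have "2 * \<bar>w N\<bar> < real N' * e"
        using N' e by (simp add: field_simps)
      also have "\<dots> \<le> real n * e"
        using n e by simp
      also have "\<dots> \<le> real n * (real n + 1) * e"
        using n e by (simp add: algebra_simps)
      also have "\<dots> \<le> 2 * w n"
        using * n mult_left_mono[of "e / 2" "a n - K" "real n * (real n + 1)"] by (simp add: w_def)
      also have "\<dots> \<le> 2 * \<bar>w N\<bar>"
        using bound[of n] n by simp
      finally show False by simp
    qed
  qed
qed

section \<open>Tangents of convex functions and gradients relative to a convex set\<close>

text \<open>The derivative is known only within \<open>A\<close>, and \<open>x\<close> may be a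
  boundary point, so the argument stays on the segment from \<open>x\<close> to \<open>y\<close>. At
  \<open>z = x + t (y - x)\<close> the first-order expansion is compared with the chord bound
  \<open>f z - f x \<le> t (f y - f x)\<close>, and \<open>t\<close> cancels.\<close>

lemma convex_on_ge_tangent:
  fixes f :: "'a::euclidean_space \<Rightarrow> real"
  assumes f: "convex_on A f" and der: "(f has_derivative (\<lambda>h. v \<bullet> h)) (at x within A)"
    and x: "x \<in> A" and y: "y \<in> A"
  shows "f x + v \<bullet> (y - x) \<le> f y"
proof (cases "y = x")
  case False
  have A: "convex A"
    using f by (rule convex_on_imp_convex)
  have pos: "norm (y - x) > 0"
    using False by simp
  have "v \<bullet> (y - x) \<le> f y - f x + e" if "e > 0" for e
  proof -
    \<comment> \<open>With this scaling the first-order error at \<open>z\<close> is exactly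
      \<open>t e\<close>.\<close>
    define e' where "e' = e / norm (y - x)"
    have "e' > 0"
      using pos that by (simp add: e'_def)
    then obtain d where d: "d > 0"
      "\<And>z. z \<in> A \<Longrightarrow> norm (z - x) < d \<Longrightarrow> norm (f z - f x - v \<bullet> (z - x)) \<le> e' * norm (z - x)"
      using der unfolding has_derivative_within_alt by metis
    define t where "t = min 1 (d / (2 * norm (y - x)))"
    have t: "0 < t" "t \<le> 1" "t * norm (y - x) < d"
      using d pos by (auto simp: t_def min_def field_simps)
    define z where "z = (1 - t) *\<^sub>R x + t *\<^sub>R y"
    have zx: "z - x = t *\<^sub>R (y - x)"
      by (simp add: z_def algebra_simps)
    have "z \<in> A"
      unfolding z_def using A x y t by (intro convexD_alt) auto
    then have "norm (f z - f x - v \<bullet> (z - x)) \<le> e' * norm (z - x)"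
      using t by (intro d) (auto simp: zx)
    then have "t * (v \<bullet> (y - x)) - t * e \<le> f z - f x"
      using t pos by (auto simp: zx e'_def abs_le_iff mult.commute)
    also have "f z - f x \<le> t * (f y - f x)"
      using convex_onD[OF f, of t x y] t x y by (simp add: z_def algebra_simps)
    finally have "t * (v \<bullet> (y - x)) \<le> t * (f y - f x + e)"
      by (simp add: algebra_simps)
    then show ?thesis
      using t(1) by simp
  qed
  then have "v \<bullet> (y - x) \<le> f y - f x"
    by (rule field_le_epsilon)
  then show ?thesis by simp
qed simp

text \<open>The gradient relative to \<open>E\<close> is the orthogonal projection of
  \<open>a\<close> onto the direction space of \<open>E\<close>, since the component of
  \<open>a\<close> orthogonal to that space is invisible to the derivative within
  \<open>E\<close>.\<close>

lemma gradient_on_subset_orthogonal: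
  assumes E: "convex E" "E \<subseteq> A" "x \<in> E"
    and der: "(g has_derivative (\<lambda>h. a \<bullet> h)) (at x within A)"
    and w: "w \<in> span {y - z |y z. y \<in> E \<and> z \<in> E}"
  shows "gradient_on E g x \<bullet> w = a \<bullet> w"
proof -
  let ?V = "{y - z |y z. y \<in> E \<and> z \<in> E}"
  obtain v z where v: "v \<in> span ?V" and z: "\<And>w. w \<in> span ?V \<Longrightarrow> orthogonal z w" and a: "a = v + z"
    using orthogonal_subspace_decomp_exists by blast
  have eq: "a \<bullet> w = v \<bullet> w" if "w \<in> span ?V" for w
    using z[OF that] by (simp add: a inner_add_left orthogonal_def)
  have "a \<bullet> (y - x) = v \<bullet> (y - x)" if "y \<in> E" for y
    using that E by (intro eq span_base) blast
  moreover have "(g has_derivative (\<lambda>h. a \<bullet> h)) (at x within E)"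
    using der E(2) by (rule has_derivative_subset)
  ultimately have "(g has_derivative (\<lambda>h. v \<bullet> h)) (at x within E)"
    using E(3) unfolding has_derivative_within_alt by (auto simp: bounded_linear_inner_right)
  with v have "gradient_on E g x = v"
    by (intro gradient_on_eq E) (simp add: is_gradient_on_def)
  then show ?thesis
    using eq[OF w] by simp
qed

lemma has_derivative_gradient_on:
  assumes "convex A" "x \<in> A" "C1_on A g"
  shows "(g has_derivative (\<lambda>h. gradient_on A g x \<bullet> h)) (at x within A)"
    and "gradient_on A g x \<in> span {y - z |y z. y \<in> A \<and> z \<in> A}"
  using is_gradient_on_gradient_on[of A x g] assms
  by (auto simp: C1_on_def differentiable_on_def is_gradient_on_def)

text \<open>Passing from the gradient relative to \<open>A\<close> to the one relative to
  \<open>E\<close> is an orthogonal projection onto a space that does not depend on the point.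
  Projections are nonexpansive, so continuity is inherited.\<close>

lemma C1_on_subset:
  assumes A: "convex A" "C1_on A g" and E: "convex E" "E \<subseteq> A"
  shows "C1_on E g"
  unfolding C1_on_def
proof
  show diff: "g differentiable_on E"
    using A E by (auto simp: C1_on_def intro: differentiable_on_subset)
  let ?V = "{y - z |y z. y \<in> E \<and> z \<in> E}"
  have grad: "gradient_on E g x \<in> span ?V" if "x \<in> E" for x
    using is_gradient_on_gradient_on[OF E(1) that] diff that
    by (auto simp: differentiable_on_def is_gradient_on_def)
  have nonexp: "dist (gradient_on E g y) (gradient_on E g x) \<le> dist (gradient_on A g y) (gradient_on A g x)"
    if "x \<in> E" "y \<in> E" for x y
  proof -
    let ?d = "gradient_on E g y - gradient_on E g x"
    have d: "?d \<in> span ?V"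
      using that grad by (intro span_diff)
    have "?d \<bullet> ?d = (gradient_on A g y - gradient_on A g x) \<bullet> ?d"
      using gradient_on_subset_orthogonal[OF E _ has_derivative_gradient_on(1)[OF A(1) _ A(2)] d] that E
      by (simp add: inner_diff_left subset_iff)
    also have "\<dots> \<le> norm (gradient_on A g y - gradient_on A g x) * norm ?d"
      by (rule norm_cauchy_schwarz)
    finally have "norm ?d * norm ?d \<le> norm (gradient_on A g y - gradient_on A g x) * norm ?d"
      by (simp add: power2_norm_eq_inner[symmetric] power2_eq_square)
    then show ?thesis
      by (cases "?d = 0") (auto simp: dist_norm)
  qed
  have "continuous_on E (gradient_on A g)"
    using A E by (auto simp: C1_on_def intro: continuous_on_subset)
  then show "continuous_on E (gradient_on E g)"
    unfolding continuous_on_iff using nonexp by (meson le_less_trans)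
qed

lemma gradient_on_diff:
  assumes "convex E" "x \<in> E" "C1_on E g" "C1_on E h"
  shows "gradient_on E (\<lambda>x. g x - h x) x = gradient_on E g x - gradient_on E h x"
proof (rule gradient_on_eq)
  show "is_gradient_on E (\<lambda>x. g x - h x) x (gradient_on E g x - gradient_on E h x)"
    using has_derivative_gradient_on[OF assms(1,2,3)] has_derivative_gradient_on[OF assms(1,2,4)]
      has_derivative_diff[of g _ "at x within E" h]
    by (auto simp: is_gradient_on_def inner_diff_left span_diff)
qed (use assms in auto)

lemma C1_on_diff:
  assumes "convex E" "C1_on E g" "C1_on E h"
  shows "C1_on E (\<lambda>x. g x - h x)"
  using assms gradient_on_diff[OF assms(1) _ assms(2,3)]
  by (auto simp: C1_on_def intro!: differentiable_on_diff continuous_on_diff cong: continuous_on_cong)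

section \<open>Suprema, Hausdorff distance and distance to a convex set\<close>

text \<open>Compactness supplies the boundedness without which a real \<open>SUP\<close> is
  unspecified. The suprema in \<open>C1_norm\<close>, \<open>hausdorff_dist\<close> and
  \<open>L\<close> are all handled through this bound.\<close>

lemma norm_le_SUP_norm:
  fixes g :: "'a::topological_space \<Rightarrow> 'b::real_normed_vector"
  assumes "compact E" "continuous_on E g" "x \<in> E"
  shows "norm (g x) \<le> (SUP x\<in>E. norm (g x))"
  using assms by (intro cSUP_upper bounded_imp_bdd_above compact_imp_bounded compact_continuous_image)
    (auto intro: continuous_intros)

lemma norm_gradient_diff_le_C1_dist:
  assumes E: "compact E" "convex E" "x \<in> E" and g: "C1_on E g" "C1_on E h"
  shows "norm (gradient_on E g x - gradient_on E h x) \<le> C1_dist E g h"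
proof -
  have C1: "C1_on E (\<lambda>x. g x - h x)"
    using C1_on_diff[OF E(2) g] .
  then have "norm (gradient_on E (\<lambda>x. g x - h x) x) \<le> (SUP x\<in>E. norm (gradient_on E (\<lambda>x. g x - h x) x))"
    using E by (intro norm_le_SUP_norm) (auto simp: C1_on_def)
  moreover have "0 \<le> (SUP x\<in>E. \<bar>g x - h x\<bar>)"
    using norm_le_SUP_norm[OF E(1) differentiable_imp_continuous_on E(3), of "\<lambda>x. g x - h x"] C1
    by (auto simp: C1_on_def intro: order_trans[OF abs_ge_zero])
  ultimately show ?thesis
    using gradient_on_diff[OF E(2,3) g] by (simp add: C1_dist_def C1_norm_def)
qed

text \<open>Both argument orders occur later: points of an approximating domain are measured against
  \<open>D\<close>, and points of \<open>D\<close> against an approximating domain.\<close>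

lemma infdist_le_hausdorff_dist:
  assumes "compact X"
  shows "x \<in> X \<Longrightarrow> infdist x Y \<le> hausdorff_dist X Y" "x \<in> X \<Longrightarrow> infdist x Y \<le> hausdorff_dist Y X"
proof -
  assume x: "x \<in> X"
  have "infdist x Y \<le> (SUP x\<in>X. infdist x Y)"
    using norm_le_SUP_norm[OF assms _ x, of "\<lambda>x. infdist x Y"] by (simp add: infdist_nonneg continuous_intros)
  then show "infdist x Y \<le> hausdorff_dist X Y" "infdist x Y \<le> hausdorff_dist Y X"
    by (auto simp: hausdorff_dist_def)
qed

text \<open>Nearest points to \<open>x\<close> and \<open>y\<close> combine to a point of
  \<open>A\<close> that competes in the infimum at the combination. This convexity is what makes the
  distance of the iterates to \<open>D\<close> obey an averaging recursion.\<close>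

lemma convex_on_infdist:
  fixes A :: "'a::euclidean_space set"
  assumes A: "convex A" "closed A" "A \<noteq> {}"
  shows "convex_on UNIV (\<lambda>x. infdist x A)"
proof (rule convex_onI)
  fix t :: real and x y :: 'a
  assume t: "0 < t" "t < 1"
  obtain a b where ab: "a \<in> A" "infdist x A = dist x a" "b \<in> A" "infdist y A = dist y b"
    using infdist_attains_inf[OF A(2,3)] by metis
  have "infdist ((1 - t) *\<^sub>R x + t *\<^sub>R y) A \<le> dist ((1 - t) *\<^sub>R x + t *\<^sub>R y) ((1 - t) *\<^sub>R a + t *\<^sub>R b)"
    using A t ab by (intro infdist_le convexD_alt) auto
  also have "\<dots> = norm ((1 - t) *\<^sub>R (x - a) + t *\<^sub>R (y - b))"
    by (simp add: dist_norm algebra_simps)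
  also have "\<dots> \<le> (1 - t) * dist x a + t * dist y b"
    using t by (intro order_trans[OF norm_triangle_ineq]) (simp add: dist_norm)
  finally show "infdist ((1 - t) *\<^sub>R x + t *\<^sub>R y) A \<le> (1 - t) * infdist x A + t * infdist y A"
    by (simp add: ab)
qed simp

section \<open>A single sample path of the algorithm\<close>

text \<open>The pointwise assumptions on \<open>K\<close>, \<open>F\<close> and \<open>s\<close> use
  indices \<open>Suc n\<close>, because their entries at 0 are arbitrary; the limits superior do not
  see these entries.\<close>

context
  fixes f :: "'a::euclidean_space \<Rightarrow> real" and A D E :: "'a set" and K :: "nat \<Rightarrow> 'a set"
    and F :: "nat \<Rightarrow> 'a \<Rightarrow> real" and x s :: "nat \<Rightarrow> 'a" and \<eta>1 \<eta>2 L :: real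
  assumes f: "convex_on A f" "C1_on A f"
    and D: "D \<in> convex_bodies"
    and E: "E \<in> convex_bodies" "D \<subseteq> E" "E \<subseteq> A"
    and K: "\<And>n. K (Suc n) \<in> convex_bodies" "\<And>n. K (Suc n) \<subseteq> E"
    and F: "\<And>n. C1_on E (F (Suc n))"
    and x0: "x 0 \<in> E"
    and xSuc: "\<And>n. x (Suc n) = x n + (2 / (real n + 2)) *\<^sub>R (s (Suc n) - x n)"
    and s: "\<And>n. is_arg_min (\<lambda>u. u \<bullet> gradient_on E (F (Suc n)) (x n)) (\<lambda>u. u \<in> K (Suc n)) (s (Suc n))"
    and K_lim: "limsup (\<lambda>n. ereal (hausdorff_dist (K n) D)) \<le> ereal \<eta>1"
    and F_lim: "limsup (\<lambda>n. ereal (C1_dist E (F n) f)) \<le> ereal \<eta>2"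
    and L: "L = (SUP x\<in>E. norm (gradient_on A f x))"
begin

lemma fw_convex: "convex A" "convex E" "compact E" "E \<noteq> {}" "convex D" "compact D" "D \<noteq> {}"
  using f E D by (auto simp: convex_bodies_def convex_on_imp_convex)

lemma fw_gradient_continuous: "continuous_on E (gradient_on A f)"
  using f E by (auto simp: C1_on_def intro: continuous_on_subset)

lemma fw_continuous: "continuous_on D f"
proof -
  have "continuous_on A f"
    using f(2) by (simp add: C1_on_def differentiable_imp_continuous_on)
  then show ?thesis
    by (rule continuous_on_subset) (use E in blast)
qed

lemma fw_gradient_le: "y \<in> E \<Longrightarrow> norm (gradient_on A f y) \<le> L"
  unfolding L using fw_gradient_continuous by (intro norm_le_SUP_norm fw_convex)

lemma fw_L_nonneg: "0 \<le> L"
  using fw_gradient_le fw_convex(4) by (meson ex_in_conv norm_ge_zero order_trans)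

lemma fw_tangent: "y \<in> E \<Longrightarrow> z \<in> E \<Longrightarrow> f y + gradient_on A f y \<bullet> (z - y) \<le> f z"
  using E f fw_convex by (intro convex_on_ge_tangent[OF f(1)] has_derivative_gradient_on) auto

lemma fw_lipschitz:
  assumes "y \<in> E" "z \<in> E"
  shows "f y \<le> f z + L * dist y z"
proof -
  have "gradient_on A f y \<bullet> (y - z) \<le> norm (gradient_on A f y) * norm (y - z)"
    by (rule norm_cauchy_schwarz)
  also have "\<dots> \<le> L * dist y z"
    unfolding dist_norm using assms by (intro mult_right_mono fw_gradient_le) auto
  finally show ?thesis
    using fw_tangent[OF assms] by (simp add: inner_diff_right)
qed

lemma fw_s_mem: "s (Suc n) \<in> K (Suc n)" "s (Suc n) \<in> E"
proof -
  show "s (Suc n) \<in> K (Suc n)"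
    using s[of n] by (simp add: is_arg_min_def)
  then show "s (Suc n) \<in> E"
    using K(2) by blast
qed

lemma fw_x_Suc: "x (Suc n) = (1 - 2 / (real n + 2)) *\<^sub>R x n + (2 / (real n + 2)) *\<^sub>R s (Suc n)"
  by (simp add: xSuc algebra_simps)

lemma fw_x_mem: "x n \<in> E"
proof (induction n)
  case (Suc n)
  then show ?case
    unfolding fw_x_Suc using fw_s_mem by (intro convexD_alt fw_convex) auto
qed (fact x0)

lemma fw_hausdorff_eventually:
  assumes "e > 0"
  shows "eventually (\<lambda>n. hausdorff_dist (K (Suc n)) D \<le> \<eta>1 + e) sequentially"
  using K_lim assms unfolding limsup_le_iff_eventually
  by (simp add: eventually_sequentially_Suc[of "\<lambda>n. hausdorff_dist (K n) D \<le> \<eta>1 + e"])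

lemma fw_C1_dist_eventually:
  assumes "e > 0"
  shows "eventually (\<lambda>n. C1_dist E (F (Suc n)) f \<le> \<eta>2 + e) sequentially"
  using F_lim assms unfolding limsup_le_iff_eventually
  by (simp add: eventually_sequentially_Suc[of "\<lambda>n. C1_dist E (F n) f \<le> \<eta>2 + e"])

lemma fw_infdist_eventually:
  assumes "e > 0"
  shows "eventually (\<lambda>n. infdist (x n) D \<le> \<eta>1 + e) sequentially"
proof (rule eventually_le_of_averaging)
  fix n
  have "infdist (x (Suc n)) D
      \<le> (1 - 2 / (real n + 2)) * infdist (x n) D + 2 / (real n + 2) * infdist (s (Suc n)) D"
    unfolding fw_x_Suc
    by (intro convex_onD[OF convex_on_infdist]) (auto simp: fw_convex compact_imp_closed)
  also have "\<dots> \<le> (1 - 2 / (real n + 2)) * infdist (x n) D + 2 / (real n + 2) * hausdorff_dist (K (Suc n)) D"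
    using K fw_s_mem
    by (intro add_left_mono mult_left_mono infdist_le_hausdorff_dist) (auto simp: convex_bodies_def)
  finally show "infdist (x (Suc n)) D
      \<le> (1 - 2 / (real n + 2)) * infdist (x n) D + 2 / (real n + 2) * hausdorff_dist (K (Suc n)) D" .
qed (use fw_hausdorff_eventually assms in auto)

lemma fw_lower: "ereal ((INF x\<in>D. f x) - \<eta>1 * L) \<le> liminf (\<lambda>n. ereal (f (x n)))"
proof (rule ereal_le_epsilon2)
  fix e :: real assume e: "e > 0"
  \<comment> \<open>The summand 1 keeps the denominator positive when \<open>L = 0\<close>.\<close>
  define e' where "e' = e / (L + 1)"
  have e': "e' > 0" "L * e' \<le> e"
    using e fw_L_nonneg by (auto simp: e'_def field_simps)
  have bdd: "bdd_below (f ` D)"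
    by (intro bounded_imp_bdd_below compact_imp_bounded compact_continuous_image
        fw_continuous fw_convex)
  have "eventually (\<lambda>n. ereal ((INF x\<in>D. f x) - \<eta>1 * L - e) \<le> ereal (f (x n))) sequentially"
    using fw_infdist_eventually[OF e'(1)]
  proof eventually_elim
    case (elim n)
    obtain y where y: "y \<in> D" "infdist (x n) D = dist (x n) y"
      using infdist_attains_inf[of D "x n"] fw_convex compact_imp_closed by metis
    have "(INF x\<in>D. f x) \<le> f y"
      using bdd y by (intro cINF_lower)
    also have "f y \<le> f (x n) + L * dist (x n) y"
      using fw_lipschitz[of y "x n"] y E fw_x_mem by (auto simp: dist_commute)
    also have "L * dist (x n) y \<le> L * (\<eta>1 + e')"
      using elim y fw_L_nonneg by (intro mult_left_mono) auto
    also have "\<dots> \<le> \<eta>1 * L + e"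
      using e' by (simp add: algebra_simps)
    finally show ?case by simp
  qed
  then have "ereal ((INF x\<in>D. f x) - \<eta>1 * L - e) \<le> liminf (\<lambda>n. ereal (f (x n)))"
    by (rule Liminf_bounded)
  then have "ereal ((INF x\<in>D. f x) - \<eta>1 * L - e) + ereal e \<le> liminf (\<lambda>n. ereal (f (x n))) + ereal e"
    by (rule add_right_mono)
  then show "ereal ((INF x\<in>D. f x) - \<eta>1 * L) \<le> liminf (\<lambda>n. ereal (f (x n))) + ereal e"
    by simp
qed

lemma fw_dist_le_diameter: "y \<in> E \<Longrightarrow> z \<in> E \<Longrightarrow> norm (y - z) \<le> diameter E"
  using diameter_bounded_bound[of E y z] fw_convex by (simp add: compact_imp_bounded dist_norm)

text \<open>The tangent is used at \<open>x (Suc n)\<close>, whereas \<open>s (Suc n)\<close> is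
  chosen by a gradient at \<open>x n\<close>. As \<open>f\<close> is only C1, no curvature constant
  controls the discrepancy; steps of length at most \<open>2 / (n + 2)\<close> times the diameter
  and uniform continuity make it vanish.\<close>

lemma fw_gradient_step_tendsto:
  "(\<lambda>n. norm (gradient_on A f (x (Suc n)) - gradient_on A f (x n))) \<longlonglongrightarrow> 0"
proof -
  have "(\<lambda>n. x (Suc n) - x n) \<longlonglongrightarrow> 0"
  proof (rule Lim_null_comparison)
    show "eventually (\<lambda>n. norm (x (Suc n) - x n) \<le> 2 / (real n + 2) * diameter E) sequentially"
      using fw_dist_le_diameter[OF fw_s_mem(2) fw_x_mem]
      by (intro always_eventually allI) (simp add: xSuc divide_right_mono)
    have "(\<lambda>n. 2 / (real n + 2)) \<longlonglongrightarrow> 0"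
      by real_asymp
    then show "(\<lambda>n. 2 / (real n + 2) * diameter E) \<longlonglongrightarrow> 0"
      by (rule tendsto_mult_left_zero)
  qed
  moreover have "uniformly_continuous_on E (gradient_on A f)"
    by (intro compact_uniformly_continuous fw_gradient_continuous fw_convex)
  ultimately show ?thesis
    unfolding uniformly_continuous_on_sequentially using fw_x_mem
    by (auto simp: dist_norm tendsto_norm_zero_iff)
qed

lemma fw_minimizer: "\<exists>z\<in>D. f z = (INF x\<in>D. f x)"
proof -
  obtain z where z: "z \<in> D" "\<And>y. y \<in> D \<Longrightarrow> f z \<le> f y"
    using continuous_attains_inf[OF fw_convex(6,7) fw_continuous] by blast
  then have "(INF x\<in>D. f x) = f z"
    by (intro cInf_eq_minimum) auto
  with z show ?thesis by auto
qed

text \<open>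
  Comparing \<open>s (Suc n)\<close> with a nearest point \<open>y\<close> to \<open>z\<close> in \<open>K (Suc n)\<close>, the gradient error is only
  tested on \<open>y - s (Suc n)\<close>, so it enters with factor \<open>diameter E\<close> rather than twice that.
\<close>

lemma fw_descent_direction:
  assumes z: "z \<in> D"
  shows "gradient_on A f (x n) \<bullet> (s (Suc n) - x n)
    \<le> f z - f (x n) + L * hausdorff_dist (K (Suc n)) D + C1_dist E (F (Suc n)) f * diameter E"
proof -
  define a where "a = gradient_on A f (x n)"
  define b where "b = gradient_on E f (x n)"
  define g where "g = gradient_on E (F (Suc n)) (x n)"
  have Kn: "compact (K (Suc n))" "K (Suc n) \<noteq> {}"
    using K by (auto simp: convex_bodies_def)
  obtain y where y: "y \<in> K (Suc n)" "infdist z (K (Suc n)) = dist z y"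
    using infdist_attains_inf[of "K (Suc n)" z] Kn compact_imp_closed by metis
  then have yz: "norm (y - z) \<le> hausdorff_dist (K (Suc n)) D"
    using infdist_le_hausdorff_dist(2)[OF fw_convex(6) z, of "K (Suc n)"]
    by (simp add: dist_norm norm_minus_commute)
  have mem: "y \<in> E" "z \<in> E" "s (Suc n) \<in> E" "x n \<in> E"
    using y K z E fw_s_mem fw_x_mem by blast+
  have "g \<bullet> s (Suc n) \<le> g \<bullet> y"
    using s[of n] y(1) by (auto simp: is_arg_min_def g_def inner_commute not_less)
  \<comment> \<open>\<open>L\<close> bounds gradients of \<open>f\<close> relative to
    \<open>A\<close>, while \<open>C1_dist\<close> compares gradients relative to \<open>E\<close>.
    The two agree on directions between points of \<open>E\<close>.\<close>
  moreover have "b \<bullet> (y - s (Suc n)) = a \<bullet> (y - s (Suc n))"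
    unfolding a_def b_def using mem fw_convex E f
    by (intro gradient_on_subset_orthogonal[where A = A] has_derivative_gradient_on span_base) auto
  \<comment> \<open>Split \<open>s (Suc n) - x n\<close> as
    \<open>(z - x n) + (y - z) - (y - s (Suc n))\<close>. On the last piece \<open>a\<close> may be
    replaced by \<open>b = g - (g - b)\<close>, and minimality of \<open>s (Suc n)\<close> gives the
    \<open>g\<close> part the favourable sign.\<close>
  ultimately have "a \<bullet> (s (Suc n) - x n)
      \<le> a \<bullet> (z - x n) + a \<bullet> (y - z) + (g - b) \<bullet> (y - s (Suc n))"
    by (simp add: inner_diff_left inner_diff_right)
  also have "a \<bullet> (z - x n) \<le> f z - f (x n)"
    using fw_tangent[of "x n" z] mem by (simp add: a_def)
  also have "a \<bullet> (y - z) \<le> L * hausdorff_dist (K (Suc n)) D"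
    using mem yz fw_L_nonneg unfolding a_def
    by (intro order_trans[OF norm_cauchy_schwarz] mult_mono fw_gradient_le) auto
  also have "(g - b) \<bullet> (y - s (Suc n)) \<le> C1_dist E (F (Suc n)) f * diameter E"
  proof -
    have "norm (g - b) \<le> C1_dist E (F (Suc n)) f"
      unfolding g_def b_def using f E fw_convex F mem C1_on_subset[of A f E]
      by (intro norm_gradient_diff_le_C1_dist) auto
    then show ?thesis
      using fw_dist_le_diameter[OF mem(1,3)]
      by (intro order_trans[OF norm_cauchy_schwarz] mult_mono) (auto intro: order_trans[OF norm_ge_zero])
  qed
  finally show ?thesis
    by (simp add: a_def)
qed

lemma fw_upper: "limsup (\<lambda>n. ereal (f (x n))) \<le> ereal ((INF x\<in>D. f x) + \<eta>1 * L + \<eta>2 * diameter E)"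
proof -
  obtain z where z: "z \<in> D" "f z = (INF x\<in>D. f x)"
    using fw_minimizer by blast
  define r where "r n = norm (gradient_on A f (x (Suc n)) - gradient_on A f (x n))" for n
  \<comment> \<open>The optimal value \<open>f z\<close> is built into \<open>c\<close>, so the
    averaging lemma applies to the values \<open>f (x n)\<close> themselves instead of to the
    gap.\<close>
  define c where "c n = f z + L * hausdorff_dist (K (Suc n)) D
    + C1_dist E (F (Suc n)) f * diameter E + r n * diameter E" for n
  have diam: "0 \<le> diameter E"
    using fw_convex by (intro diameter_ge_0 compact_imp_bounded)
  have "eventually (\<lambda>n. f (x n) \<le> (f z + \<eta>1 * L + \<eta>2 * diameter E) + e) sequentially" if "e > 0" for e
    using _ _ that
  proof (rule eventually_le_of_averaging)
    fix n
    let ?l = "2 / (real n + 2)" and ?g = "gradient_on A f"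
    \<comment> \<open>The tangent is taken at the new iterate: there it bounds
      \<open>f (x (Suc n))\<close> from above, while the tangent at \<open>x n\<close> would bound
      it from below.\<close>
    have "f (x (Suc n)) \<le> f (x n) + ?g (x (Suc n)) \<bullet> (x (Suc n) - x n)"
      using fw_tangent[OF fw_x_mem fw_x_mem, of "Suc n" n] by (simp add: inner_diff_right)
    also have "\<dots> = f (x n) + ?l * (?g (x n) \<bullet> (s (Suc n) - x n)
        + (?g (x (Suc n)) - ?g (x n)) \<bullet> (s (Suc n) - x n))"
      unfolding xSuc by (simp add: inner_diff_left)
    also have "\<dots> \<le> f (x n) + ?l * (c n - f (x n))"
    proof (intro add_left_mono mult_left_mono)
      have "(?g (x (Suc n)) - ?g (x n)) \<bullet> (s (Suc n) - x n) \<le> r n * diameter E"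
        using fw_dist_le_diameter[OF fw_s_mem(2) fw_x_mem] unfolding r_def
        by (intro order_trans[OF norm_cauchy_schwarz] mult_left_mono) auto
      then show "?g (x n) \<bullet> (s (Suc n) - x n) + (?g (x (Suc n)) - ?g (x n)) \<bullet> (s (Suc n) - x n)
          \<le> c n - f (x n)"
        using fw_descent_direction[OF z(1), of n] by (simp add: c_def)
    qed simp
    also have "\<dots> = (1 - ?l) * f (x n) + ?l * c n"
      using left_diff_distrib[of 1 ?l "f (x n)"] right_diff_distrib[of ?l "c n" "f (x n)"] by linarith
    finally show "f (x (Suc n)) \<le> (1 - ?l) * f (x n) + ?l * c n" .
  next
    fix e :: real assume e: "e > 0"
    \<comment> \<open>The error \<open>e'\<close> enters with factor \<open>L\<close> through the
      Hausdorff distance and twice with factor \<open>diameter E\<close>, through the objective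
      error and through \<open>r n\<close>; the summand 1 keeps the denominator positive.\<close>
    define e' where "e' = e / (L + 2 * diameter E + 1)"
    have e': "e' > 0" "(L + 2 * diameter E) * e' \<le> e"
      using e diam fw_L_nonneg by (auto simp: e'_def field_simps add_nonneg_pos)
    have "eventually (\<lambda>n. r n < e') sequentially"
      using fw_gradient_step_tendsto e'(1) unfolding r_def by (rule order_tendstoD)
    with fw_hausdorff_eventually[OF e'(1)] fw_C1_dist_eventually[OF e'(1)]
    show "eventually (\<lambda>n. c n \<le> (f z + \<eta>1 * L + \<eta>2 * diameter E) + e) sequentially"
    proof eventually_elim
      case (elim n)
      have "c n \<le> f z + L * (\<eta>1 + e') + (\<eta>2 + e') * diameter E + e' * diameter E"
        unfolding c_def using elim diam fw_L_nonneg
        by (intro add_mono mult_left_mono mult_right_mono) auto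
      also have "\<dots> = f z + \<eta>1 * L + \<eta>2 * diameter E + (L + 2 * diameter E) * e'"
        by (simp add: algebra_simps)
      finally show ?case
        using e'(2) by simp
    qed
  qed
  then show ?thesis
    unfolding limsup_le_iff_eventually z(2) by blast
qed

end

section \<open>Measurability and passage to probabilities\<close>

text \<open>
  Outside \<open>A\<close> the function \<open>f\<close> is arbitrary, and \<open>x 0\<close> need not lie in \<open>A\<close>; the limits do not see
  the index \<open>0\<close>.
\<close>

lemma limits_event_measurable:
  fixes x :: "nat \<Rightarrow> 'w \<Rightarrow> 'a::euclidean_space" and f :: "'a \<Rightarrow> real"
  assumes A: "closed A" and f: "continuous_on A f" and x[measurable]: "\<And>n. x n \<in> borel_measurable M"
    and B[measurable]: "B \<in> sets (borel \<Otimes>\<^sub>M borel)"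
  shows "{\<omega> \<in> space M. (\<forall>n\<ge>1. x n \<omega> \<in> A) \<and>
      (liminf (\<lambda>n. ereal (f (x n \<omega>))), limsup (\<lambda>n. ereal (f (x n \<omega>)))) \<in> B} \<in> sets M"
proof -
  \<comment> \<open>Setting \<open>f\<close> to 0 outside the closed set \<open>A\<close> gives a
    Borel function, and on the event in question its limits along the iterates are those of
    \<open>f\<close>.\<close>
  define g where "g = (\<lambda>y. indicator A y *\<^sub>R f y)"
  have A'[measurable]: "A \<in> sets borel"
    using A by simp
  have g[measurable]: "g \<in> borel_measurable borel"
    unfolding g_def by (rule borel_measurable_continuous_on_indicator[OF A' f])
  have eq: "liminf (\<lambda>n. ereal (f (x n \<omega>))) = liminf (\<lambda>n. ereal (g (x n \<omega>)))"
      "limsup (\<lambda>n. ereal (f (x n \<omega>))) = limsup (\<lambda>n. ereal (g (x n \<omega>)))"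
    if "\<forall>n\<ge>1. x n \<omega> \<in> A" for \<omega>
    using that
    by (auto intro!: Liminf_eq Limsup_eq eventually_sequentiallyI[of 1] simp: g_def)
  have "{\<omega> \<in> space M. (\<forall>n\<ge>1. x n \<omega> \<in> A) \<and>
      (liminf (\<lambda>n. ereal (g (x n \<omega>))), limsup (\<lambda>n. ereal (g (x n \<omega>)))) \<in> B} \<in> sets M"
    by measurable
  also have "{\<omega> \<in> space M. (\<forall>n\<ge>1. x n \<omega> \<in> A) \<and>
      (liminf (\<lambda>n. ereal (g (x n \<omega>))), limsup (\<lambda>n. ereal (g (x n \<omega>)))) \<in> B} =
    {\<omega> \<in> space M. (\<forall>n\<ge>1. x n \<omega> \<in> A) \<and>
      (liminf (\<lambda>n. ereal (f (x n \<omega>))), limsup (\<lambda>n. ereal (f (x n \<omega>)))) \<in> B}"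
    using eq by auto
  finally show ?thesis .
qed

lemma (in prob_space) prob_Int3_ge:
  assumes "A \<in> events" "B \<in> events" "C \<in> events"
    and "prob A \<ge> 1 - a" "prob B \<ge> 1 - b" "prob C \<ge> 1 - c"
  shows "prob (A \<inter> B \<inter> C) \<ge> 1 - (a + b + c)"
proof -
  have "prob (space M - A \<inter> B \<inter> C) = prob ((space M - A) \<union> (space M - B) \<union> (space M - C))"
    by (rule arg_cong[where f = prob]) auto
  also have "\<dots> \<le> prob (space M - A) + prob (space M - B) + prob (space M - C)"
    using assms measure_Un_le[of "(space M - A) \<union> (space M - B)" M "space M - C"]
      measure_Un_le[of "space M - A" M "space M - B"] by auto
  finally show ?thesis
    using assms by (simp add: prob_compl)
qed

theorem theorem1:
  fixes M :: "'w measure"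
    and f :: "'a::euclidean_space \<Rightarrow> real"
    and domf D E :: "'a set"
    and Dn :: "nat \<Rightarrow> 'w \<Rightarrow> 'a set"
    and Fn :: "nat \<Rightarrow> 'w \<Rightarrow> 'a \<Rightarrow> real"
    and S X :: "nat \<Rightarrow> 'w \<Rightarrow> 'a"
    and \<beta>1 \<beta>2 \<epsilon> \<eta>1 \<eta>2 Pstar \<Delta> L :: real
  assumes prob: "prob_space M" and complete: "complete_measure M"
    and domf: "closed domf" and f_convex: "convex_on domf f" and f_C1: "C1_on domf f"
    and D: "D \<in> convex_bodies" "D \<subseteq> domf"
    and Pstar: "Pstar = (INF x\<in>D. f x)"
    and E: "E \<in> convex_bodies" "D \<subseteq> E" "E \<subseteq> domf"
    and Dn: "domain_approximation_process M Dn"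
    and Fn: "objective_approximation_process M E Fn"
    and fw: "frank_wolfe_process M E Dn Fn S X"
    and \<beta>1: "0 \<le> \<beta>1" "\<beta>1 \<le> 1" and \<beta>2: "0 \<le> \<beta>2" "\<beta>2 \<le> 1" and \<epsilon>: "0 \<le> \<epsilon>" "\<epsilon> \<le> 1"
    and \<eta>1: "0 \<le> \<eta>1" and \<eta>2: "0 \<le> \<eta>2"
    and i: "measure M {\<omega> \<in> space M.
        limsup (\<lambda>n. ereal (hausdorff_dist (Dn n \<omega>) D)) \<le> ereal \<eta>1} \<ge> 1 - \<beta>1"
    and ii: "measure M {\<omega> \<in> space M. (\<Union>n\<in>{1..}. Dn n \<omega>) \<subseteq> E} \<ge> 1 - \<epsilon>"
    and iii: "measure M {\<omega> \<in> space M.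
        limsup (\<lambda>n. ereal (C1_dist E (Fn n \<omega>) f)) \<le> ereal \<eta>2} \<ge> 1 - \<beta>2"
    and \<Delta>: "\<Delta> = diameter E"
    and L: "L = (SUP x\<in>E. norm (gradient_on domf f x))"
  shows "measure M {\<omega> \<in> space M. (\<forall>n\<ge>1. X n \<omega> \<in> domf) \<and>
        ereal (- \<eta>1 * L) \<le> liminf (\<lambda>n. ereal (f (X n \<omega>))) - ereal Pstar \<and>
        liminf (\<lambda>n. ereal (f (X n \<omega>))) - ereal Pstar
          \<le> limsup (\<lambda>n. ereal (f (X n \<omega>))) - ereal Pstar \<and>
        limsup (\<lambda>n. ereal (f (X n \<omega>))) - ereal Pstar \<le> ereal (\<eta>1 * L + 2 * \<eta>2 * \<Delta>)}
      \<ge> 1 - (\<beta>1 + \<beta>2 + \<epsilon>)"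
proof -
  interpret prob_space M by (rule prob)
  \<comment> \<open>Combined with \<open>measurable_space\<close>, this turns the two process
    hypotheses into pointwise membership in \<open>convex_bodies\<close> and
    \<open>convex_C1 E\<close>.\<close>
  have space_metric_borel: "space (metric_borel B d) = B" for B :: "'b set" and d
    by (simp add: metric_borel_def space_measure_of_conv)
  define T where "T = {\<omega> \<in> space M. (\<forall>n\<ge>1. X n \<omega> \<in> domf) \<and>
        ereal (- \<eta>1 * L) \<le> liminf (\<lambda>n. ereal (f (X n \<omega>))) - ereal Pstar \<and>
        liminf (\<lambda>n. ereal (f (X n \<omega>))) - ereal Pstar
          \<le> limsup (\<lambda>n. ereal (f (X n \<omega>))) - ereal Pstar \<and>
        limsup (\<lambda>n. ereal (f (X n \<omega>))) - ereal Pstar \<le> ereal (\<eta>1 * L + 2 * \<eta>2 * \<Delta>)}"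
  define A1 where "A1 = {\<omega> \<in> space M. limsup (\<lambda>n. ereal (hausdorff_dist (Dn n \<omega>) D)) \<le> ereal \<eta>1}"
  define A2 where "A2 = {\<omega> \<in> space M. limsup (\<lambda>n. ereal (C1_dist E (Fn n \<omega>) f)) \<le> ereal \<eta>2}"
  define A3 where "A3 = {\<omega> \<in> space M. (\<Union>n\<in>{1..}. Dn n \<omega>) \<subseteq> E}"
  have X0: "AE \<omega> in M. X 0 \<omega> \<in> E"
    and X_Suc: "\<And>n \<omega>. \<omega> \<in> space M \<Longrightarrow> X (Suc n) \<omega> = X n \<omega> + (2 / (real n + 2)) *\<^sub>R (S (Suc n) \<omega> - X n \<omega>)"
    and S: "\<And>n \<omega>. \<omega> \<in> space M \<Longrightarrow> is_arg_min
          (\<lambda>s. indicat_real (feasible_event M E Dn (X 0)) \<omega> *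
               (s \<bullet> gradient_on E (Fn (Suc n) \<omega>) (X n \<omega>)))
          (\<lambda>s. s \<in> Dn (Suc n) \<omega>) (S (Suc n) \<omega>)"
    and [measurable]: "X 0 \<in> borel_measurable M" "\<And>n. S (Suc n) \<in> borel_measurable M"
    using fw unfolding frank_wolfe_process_def by blast+
  have X_meas: "X n \<in> borel_measurable M" for n
  proof (induction n)
    case (Suc n)
    note [measurable] = Suc
    have "(\<lambda>\<omega>. X n \<omega> + (2 / (real n + 2)) *\<^sub>R (S (Suc n) \<omega> - X n \<omega>)) \<in> borel_measurable M"
      by measurable
    then show ?case
      by (rule measurable_cong[THEN iffD1, rotated]) (simp add: X_Suc)
  qed simp
  have f_cont: "continuous_on domf f"
    using f_C1 by (simp add: C1_on_def differentiable_imp_continuous_on)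
  \<comment> \<open>The conditions of \<open>T\<close> on the two limits, encoded as a set of pairs
    (limit inferior, limit superior).\<close>
  define B where "B = {p \<in> space (borel \<Otimes>\<^sub>M borel). ereal (- \<eta>1 * L) \<le> fst p - ereal Pstar \<and>
      fst p - ereal Pstar \<le> snd p - ereal Pstar \<and>
      snd p - ereal Pstar \<le> ereal (\<eta>1 * L + 2 * \<eta>2 * \<Delta>)}"
  have "B \<in> sets (borel \<Otimes>\<^sub>M borel)"
    unfolding B_def by measurable
  from limits_event_measurable[where x = X, OF domf f_cont X_meas this] have T: "T \<in> events"
    by (simp only: B_def T_def space_pair_measure space_borel UNIV_Times_UNIV UNIV_I mem_Collect_eq
        fst_conv snd_conv simp_thms)
  \<comment> \<open>The start lies in \<open>E\<close> only almost surely, so this stays a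
    hypothesis here and is discharged by \<open>finite_measure_mono_AE\<close> at the end.\<close>
  have good: "\<omega> \<in> T" if \<omega>: "\<omega> \<in> A1 \<inter> A2 \<inter> A3" and "X 0 \<omega> \<in> E" for \<omega>
  proof -
    have sp: "\<omega> \<in> space M"
      using \<omega> by (auto simp: A1_def)
    have K: "Dn (Suc n) \<omega> \<in> convex_bodies" "Dn (Suc n) \<omega> \<subseteq> E" for n
    proof -
      show "Dn (Suc n) \<omega> \<in> convex_bodies"
        using measurable_space[OF _ sp, of "Dn (Suc n)"] Dn
        unfolding domain_approximation_process_def by (metis space_metric_borel Suc_eq_plus1_left le_add1)
      have "Suc n \<in> {1..}"
        by simp
      then show "Dn (Suc n) \<omega> \<subseteq> E"
        using \<omega> unfolding A3_def by blast
    qed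
    have F: "C1_on E (Fn (Suc n) \<omega>)" for n
    proof -
      have "Fn (Suc n) \<omega> \<in> convex_C1 E"
        using measurable_space[OF _ sp, of "Fn (Suc n)"] Fn
        unfolding objective_approximation_process_def by (metis space_metric_borel Suc_eq_plus1_left le_add1)
      then show ?thesis
        by (simp add: convex_C1_def)
    qed
    \<comment> \<open>On this outcome the indicator in the algorithm is 1, so the selection
      minimizes the actual linear objective.\<close>
    have ind: "\<omega> \<in> feasible_event M E Dn (X 0)"
      using \<omega> that(2) by (auto simp: feasible_event_def A3_def)
    have s: "is_arg_min (\<lambda>u. u \<bullet> gradient_on E (Fn (Suc n) \<omega>) (X n \<omega>)) (\<lambda>u. u \<in> Dn (Suc n) \<omega>) (S (Suc n) \<omega>)" for n
      using S[OF sp, of n] ind by simp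
    have lims: "limsup (\<lambda>n. ereal (hausdorff_dist (Dn n \<omega>) D)) \<le> ereal \<eta>1"
      "limsup (\<lambda>n. ereal (C1_dist E (Fn n \<omega>) f)) \<le> ereal \<eta>2"
      using \<omega> by (auto simp: A1_def A2_def)
    \<comment> \<open>These facts follow the order of the assumptions of the path analysis, with
      \<open>domf\<close> for \<open>A\<close>.\<close>
    note run = f_convex f_C1 D(1) E K F that(2) X_Suc[OF sp] s lims L
    have mem: "X n \<omega> \<in> E" for n
      by (rule fw_x_mem[OF run])
    have "ereal (Pstar - \<eta>1 * L) \<le> liminf (\<lambda>n. ereal (f (X n \<omega>)))"
      unfolding Pstar by (rule fw_lower[OF run])
    then have lower: "ereal (- \<eta>1 * L) \<le> liminf (\<lambda>n. ereal (f (X n \<omega>))) - ereal Pstar"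
      by (simp add: ereal_le_minus_iff)
    have "limsup (\<lambda>n. ereal (f (X n \<omega>))) \<le> ereal (Pstar + \<eta>1 * L + \<eta>2 * \<Delta>)"
      unfolding Pstar \<Delta> by (rule fw_upper[OF run])
    \<comment> \<open>The path analysis yields the sharper constant
      \<open>\<eta>2 * \<Delta>\<close>; nonnegativity of \<open>\<eta>2\<close> and of the diameter
      gives the factor 2.\<close>
    also have "\<dots> \<le> ereal (Pstar + \<eta>1 * L + 2 * \<eta>2 * \<Delta>)"
      using \<eta>2 E(1) diameter_ge_0[OF compact_imp_bounded, of E] by (simp add: \<Delta> convex_bodies_def)
    finally have upper: "limsup (\<lambda>n. ereal (f (X n \<omega>))) - ereal Pstar \<le> ereal (\<eta>1 * L + 2 * \<eta>2 * \<Delta>)"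
      by (simp add: ereal_minus_le_iff add_ac)
    show ?thesis
      unfolding T_def using sp mem E(3) lower upper
      by (auto intro!: ereal_minus_mono Liminf_le_Limsup)
  qed
  \<comment> \<open>A nonmeasurable event has \<open>measure\<close> 0, so measurability is automatic unless the claim is trivial.\<close>
  have "measure M T \<ge> 1 - (\<beta>1 + \<beta>2 + \<epsilon>)"
  proof (cases "\<beta>1 = 1 \<or> \<beta>2 = 1 \<or> \<epsilon> = 1")
    case True
    then have "1 - (\<beta>1 + \<beta>2 + \<epsilon>) \<le> 0"
      using \<beta>1 \<beta>2 \<epsilon> by auto
    then show ?thesis
      by (rule order_trans) simp
  next
    case False
    have P: "prob A1 \<ge> 1 - \<beta>1" "prob A2 \<ge> 1 - \<beta>2" "prob A3 \<ge> 1 - \<epsilon>"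
      using i ii iii by (simp_all add: A1_def A2_def A3_def)
    then have ev: "A1 \<in> events" "A2 \<in> events" "A3 \<in> events"
      using False \<beta>1 \<beta>2 \<epsilon> measure_notin_sets[of A1 M] measure_notin_sets[of A2 M]
        measure_notin_sets[of A3 M] by argo+
    have "1 - (\<beta>1 + \<beta>2 + \<epsilon>) \<le> prob (A1 \<inter> A2 \<inter> A3)"
      by (rule prob_Int3_ge[OF ev P])
    also have "\<dots> \<le> prob T"
      using X0 good T by (intro finite_measure_mono_AE) auto
    finally show ?thesis .
  qed
  then show ?thesis
    by (simp only: T_def)
qed

end
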